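(* Let $\mathbb{V}$ be a finite dimensional vector space over a field $\mathbb{F}$ and $\mathcal{K}=\{+\}\cup\{f_r:r\in\mathbb{F},r\neq0\}$, where $f_r(v)=r\cdot v$. Then $(\mathbb{V},\mathcal{K})$ is a Ramsey algebra.
   Context: Orderly terms $\mathrm{OT}(\mathcal{K})$: smallest collection containing $\mathcal{K}$ and $\mathrm{id}_\mathbb{V}$, closed under $f(\bar x_1,\dots,\bar x_k)=g(h_1(\bar x_1),\dots,h_k(\bar x_k))$ for $k$-ary $g\in\mathcal{K}$, orderly terms $h_i$, consecutive disjoint variable blocks $\bar x_i$. For $\vec a,\vec b\in{}^\omega\mathbb{V}$, $\vec a\le_\mathcal{K}\vec b$ means there are orderly terms $f_j$ and finite subsequences $\vec b_j$ of $\vec b$ with $\vec a(j)=f_j(\bar b_j)$ for all $j\in\omega$ and $\vec b_0\ast\vec b_1\ast\cdots$ a subsequence of $\vec b$. $\mathrm{FR}_\mathcal{K}(\vec a)=\{f(\bar\tau):f\in\mathrm{OT}(\mathcal{K}),\ \vec\tau\text{ a finite subsequence of }\vec a\}$. $(\mathbb{V},\mathcal{K})$ is a Ramsey algebra if for every $\vec b\in{}^\omega\mathbb{V}$ and $X\subseteq\mathbb{V}$ there exists $\vec a\le_\mathcal{K}\vec b$ with $\mathrm{FR}_\mathcal{K}(\vec a)\subseteq X$ or $\mathrm{FR}_\mathcal{K}(\vec a)\cap X=\varnothing$. *)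

theory Defs
  imports Complex_Main
begin

text \<open>
  The underlying set of an algebra is a whole type. An operation is an arity together with a
  function on argument lists; only its values on lists of that length matter, and it is only
  ever evaluated there.
\<close>

type_synonym 'a operation = "nat \<times> ('a list \<Rightarrow> 'a)"

fun blocks :: "nat list \<Rightarrow> 'a list \<Rightarrow> 'a list list" where
  "blocks [] xs = []"
| "blocks (n # ns) xs = take n xs # blocks ns (drop n xs)"

inductive_set orderly_terms :: "'a operation set \<Rightarrow> 'a operation set"
  for K :: "'a operation set" where
  base: "f \<in> K \<Longrightarrow> f \<in> orderly_terms K"
| ident: "(1, \<lambda>xs. xs ! 0) \<in> orderly_terms K"
| comp: "(length hs, g) \<in> K \<Longrightarrow> (\<forall>h \<in> set hs. h \<in> orderly_terms K) \<Longrightarrow>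
    (sum_list (map fst hs), \<lambda>xs. g (map2 snd hs (blocks (map fst hs) xs))) \<in> orderly_terms K"

definition finite_subsequence :: "'a list \<Rightarrow> (nat \<Rightarrow> 'a) \<Rightarrow> bool" where
  "finite_subsequence ys b \<longleftrightarrow>
     (\<exists>s. strict_mono s \<and> ys = map (b \<circ> s) [0..<length ys])"

text \<open>
  The concatenation of all lists \<open>bs 0, bs 1, \<dots>\<close> is a subsequence of \<open>b\<close>: one strictly
  increasing reindexing \<open>s\<close> of \<open>b\<close> has every finite partial concatenation as an initial segment.
\<close>

definition concat_subsequence :: "(nat \<Rightarrow> 'a list) \<Rightarrow> (nat \<Rightarrow> 'a) \<Rightarrow> bool" where
  "concat_subsequence bs b \<longleftrightarrow>
     (\<exists>s. strict_mono s \<and>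
        (\<forall>n. let ys = concat (map bs [0..<n]) in ys = map (b \<circ> s) [0..<length ys]))"

definition reduction :: "'a operation set \<Rightarrow> (nat \<Rightarrow> 'a) \<Rightarrow> (nat \<Rightarrow> 'a) \<Rightarrow> bool" where
  "reduction K a b \<longleftrightarrow>
     (\<exists>f bs. (\<forall>j. (length (bs j), f j) \<in> orderly_terms K \<and> finite_subsequence (bs j) b \<and>
                  a j = f j (bs j)) \<and>
             concat_subsequence bs b)"

definition FR :: "'a operation set \<Rightarrow> (nat \<Rightarrow> 'a) \<Rightarrow> 'a set" where
  "FR K a = {f ts | f ts. (length ts, f) \<in> orderly_terms K \<and> finite_subsequence ts a}"

definition ramsey_algebra :: "'a operation set \<Rightarrow> bool" where
  "ramsey_algebra K \<longleftrightarrow>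
     (\<forall>(b :: nat \<Rightarrow> 'a) (X :: 'a set). \<exists>a. reduction K a b \<and> (FR K a \<subseteq> X \<or> FR K a \<inter> X = {}))"

definition vector_operations ::
    "('f::zero \<Rightarrow> 'v::plus \<Rightarrow> 'v) \<Rightarrow> 'v operation set" where
  "vector_operations scale =
     {(2, \<lambda>xs. xs ! 0 + xs ! 1)} \<union> {(1, \<lambda>xs. scale r (xs ! 0)) | r. r \<noteq> 0}"

end

theory Submission
  imports Defs
begin

text \<open>
  Any \<open>d + 1\<close> consecutive entries of \<open>b\<close>, where \<open>d\<close> is the dimension, satisfy a nontrivial linear
  relation. Restricted to its support it has only nonzero coefficients, so its left-hand side
  is an orderly term in a finite subsequence of these entries. Hence the zero sequence is a reduction
  of every sequence, and \<open>0\<close> is the only value of orderly terms on it.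
\<close>

text \<open>Laid end to end, the lists form one infinite strictly increasing sequence, and
  \<open>s\<close> is that sequence. Reductions and finite subsequences both demand such an infinite
  reindexing, so finite index lists have to be embedded in one.\<close>

lemma increasing_blocks_enumeration:
  fixes I :: "nat \<Rightarrow> nat list"
  assumes nonempty: "\<And>k. I k \<noteq> []"
    and sorted: "\<And>k. sorted_wrt (<) (I k)"
    and separated: "\<And>i j x y. i < j \<Longrightarrow> x \<in> set (I i) \<Longrightarrow> y \<in> set (I j) \<Longrightarrow> x < y"
  obtains s where "strict_mono s"
    and "\<And>n. concat (map I [0..<n]) = map s [0..<length (concat (map I [0..<n]))]"
proof -
  define C where "C n = concat (map I [0..<n])" for n
  \<comment> \<open>All \<open>I k\<close> are nonempty, so \<open>C (Suc i)\<close> has at least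
    \<open>i + 1\<close> entries and position \<open>i\<close> exists. Longer concatenations extend
    shorter ones, so this entry never changes afterwards.\<close>
  define s where "s i = C (Suc i) ! i" for i
  have C_Suc: "C (Suc n) = C n @ I n" for n
    by (simp add: C_def)
  have C_sorted: "sorted_wrt (<) (C n)" for n
  proof (induction n)
    case 0
    show ?case by (simp add: C_def)
  next
    case (Suc n)
    then show ?case
      unfolding C_Suc sorted_wrt_append using sorted separated by (auto simp: C_def)
  qed
  have len: "n \<le> length (C n)" for n
  proof (induction n)
    case (Suc n)
    then show ?case
      using nonempty[of n] by (cases "I n") (auto simp: C_Suc)
  qed simp
  have nth_mono: "C n ! i = C m ! i" if "n \<le> m" "i < length (C n)" for n m i
    using that(1)
  proof (induction m rule: dec_induct)
    case (step m)
    have "length (C n) \<le> length (C m)"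
      using step.hyps(1) by (induction m rule: dec_induct) (auto simp: C_Suc)
    then show ?case
      using step that(2) by (simp add: C_Suc nth_append)
  qed simp
  have s_nth: "C n ! i = s i" if "i < length (C n)" for n i
    unfolding s_def
    using nth_mono[of n "Suc i" i] nth_mono[of "Suc i" n i] that len[of "Suc i"]
    by (metis nat_le_linear less_le_trans lessI)
  have "strict_mono s"
    unfolding strict_mono_Suc_iff
  proof
    fix i
    have "Suc i < length (C (Suc (Suc i)))"
      using len[of "Suc (Suc i)"] by simp
    then have "C (Suc (Suc i)) ! i < C (Suc (Suc i)) ! Suc i"
      by (intro sorted_wrt_nth_less[OF C_sorted]) auto
    then show "s i < s (Suc i)"
      using s_nth[of i "Suc (Suc i)"] s_nth[of "Suc i" "Suc (Suc i)"] \<open>Suc i < _\<close> by simp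
  qed
  moreover have "C n = map s [0..<length (C n)]" for n
    by (rule nth_equalityI) (simp_all only: length_map length_upt diff_zero nth_map_upt add_0 s_nth)
  ultimately show thesis
    using that unfolding C_def by blast
qed

context vector_space
begin

text \<open>By induction, \<open>+\<close> is composed with a scaling of the first argument and the
  term for the remaining ones. Zero coefficients are excluded because only nonzero scalings are
  operations, and the empty sum because every orderly term here takes an argument; the recursion
  therefore ends at one coefficient.\<close>

lemma linear_combination_orderly:
  assumes "rs \<noteq> []" "0 \<notin> set rs"
  shows "\<exists>f. (length rs, f) \<in> orderly_terms (vector_operations scale) \<and>
    (\<forall>xs. length xs = length rs \<longrightarrow> f xs = sum_list (map2 scale rs xs))"
  using assms
proof (induction rs)
  case (Cons r rs)
  let ?K = "vector_operations scale"
  let ?m = "(1, \<lambda>xs. scale r (xs ! 0)) :: 'b operation"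
  have m: "?m \<in> orderly_terms ?K"
    using Cons.prems by (intro orderly_terms.base) (auto simp: vector_operations_def)
  show ?case
  proof (cases "rs = []")
    case True
    show ?thesis
    proof (intro exI conjI allI impI)
      show "(length (r # rs), \<lambda>xs. scale r (xs ! 0)) \<in> orderly_terms ?K"
        using m True by simp
    qed (auto simp: True length_Suc_conv)
  next
    case False
    then obtain h where h: "(length rs, h) \<in> orderly_terms ?K"
      "\<And>xs. length xs = length rs \<Longrightarrow> h xs = sum_list (map2 scale rs xs)"
      using Cons by auto
    let ?g = "\<lambda>xs :: 'b list. xs ! 0 + xs ! 1"
    let ?hs = "[?m, (length rs, h)]"
    have "(length ?hs, ?g) \<in> ?K"
      by (simp add: vector_operations_def numeral_2_eq_2)
    moreover have "\<forall>h \<in> set ?hs. h \<in> orderly_terms ?K"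
      using m h(1) by simp
    ultimately have "(sum_list (map fst ?hs), \<lambda>xs. ?g (map2 snd ?hs (blocks (map fst ?hs) xs)))
        \<in> orderly_terms ?K"
      by (rule orderly_terms.comp)
    then have "(length (r # rs), \<lambda>xs. ?g (map2 snd ?hs (blocks (map fst ?hs) xs)))
        \<in> orderly_terms ?K"
      by simp
    moreover have "?g (map2 snd ?hs (blocks (map fst ?hs) xs)) = sum_list (map2 scale (r # rs) xs)"
      if "length xs = length (r # rs)" for xs
      using that h(2) by (cases xs) auto
    ultimately show ?thesis by blast
  qed
qed simp

text \<open>Addition and all scalings send zero vectors to zero, and composition preserves this
  property.\<close>

lemma orderly_term_zero:
  assumes "f \<in> orderly_terms (vector_operations scale)"
  shows "snd f (replicate (fst f) 0) = 0"
  using assms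
proof induction
  case (base f)
  then show ?case by (auto simp: vector_operations_def)
next
  case (comp hs g)
  \<comment> \<open>Each block of a zero list is again a zero list, so every inner term hands
    \<open>0\<close> to \<open>g\<close>.\<close>
  have "map2 snd hs (blocks (map fst hs) (replicate (sum_list (map fst hs)) 0))
      = replicate (length hs) 0"
    using comp.IH by (induction hs) (auto simp: min_def)
  then show ?case
    using comp.hyps by (auto simp: vector_operations_def)
qed simp

lemma FR_zero_sequence: "FR (vector_operations scale) (\<lambda>_. 0) \<subseteq> {0}"
proof -
  have "ts = replicate (length ts) 0" if "finite_subsequence ts (\<lambda>_. 0 :: 'b)" for ts
    using that by (auto simp: finite_subsequence_def comp_def map_replicate_const)
  then show ?thesis
    using orderly_term_zero unfolding FR_def by fastforce
qed

end

context finite_dimensional_vector_space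
begin

text \<open>The relation is between indices rather than vectors, since \<open>b\<close> may repeat a
  value. A repetition \<open>b i = b j\<close> gives the relation \<open>b i - b j = 0\<close>;
  without one, the image of \<open>A\<close> is a set with too many vectors to be
  independent.\<close>

lemma linear_relation_of_family:
  assumes "finite A" "card A > dimension"
  shows "\<exists>u. (\<exists>i\<in>A. u i \<noteq> 0) \<and> (\<Sum>i\<in>A. scale (u i) (b i)) = 0"
proof (cases "inj_on b A")
  case True
  then have "dependent (b ` A)"
    using assms independent_card_le_dim[of "b ` A" UNIV]
    by (auto simp: card_image dimension_def dim_UNIV)
  then obtain u where "\<exists>v\<in>b ` A. u v \<noteq> 0" "(\<Sum>v\<in>b ` A. scale (u v) v) = 0"
    using dependent_finite[of "b ` A"] assms(1) by auto
  then show ?thesis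
    using True by (intro exI[of _ "u \<circ> b"]) (auto simp: sum.reindex)
next
  case False
  then obtain i j where ij: "i \<in> A" "j \<in> A" "i \<noteq> j" "b i = b j"
    by (auto simp: inj_on_def)
  define u :: "_ \<Rightarrow> 'a" where "u = (\<lambda>k. if k = i then 1 else if k = j then - 1 else 0)"
  have "(\<Sum>k\<in>A. scale (u k) (b k)) = (\<Sum>k\<in>{i, j}. scale (u k) (b k))"
    by (rule sum.mono_neutral_right) (use assms ij in \<open>auto simp: u_def\<close>)
  also have "\<dots> = 0"
    using ij by (simp add: u_def)
  finally show ?thesis
    using ij by (intro exI[of _ u]) (auto simp: u_def)
qed

lemma zero_term_in_interval:
  fixes b :: "nat \<Rightarrow> 'b"
  shows "\<exists>is f. is \<noteq> [] \<and> sorted_wrt (<) is \<and> set is \<subseteq> {n..<n + Suc dimension} \<and>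
    (length is, f) \<in> orderly_terms (vector_operations scale) \<and> f (map b is) = 0"
proof -
  let ?A = "{n..<n + Suc dimension}"
  obtain u where u: "\<exists>i\<in>?A. u i \<noteq> 0" "(\<Sum>i\<in>?A. scale (u i) (b i)) = 0"
    using linear_relation_of_family[of ?A b] by auto
  \<comment> \<open>Passing to the support leaves the sum unchanged and makes every coefficient
    nonzero, as \<open>linear_combination_orderly\<close> requires. Sorting keeps the arguments in
    the order of \<open>b\<close>.\<close>
  define "is" where "is = sorted_list_of_set {i \<in> ?A. u i \<noteq> 0}"
  have set_is: "set is = {i \<in> ?A. u i \<noteq> 0}"
    by (simp add: is_def)
  then obtain f where f: "(length is, f) \<in> orderly_terms (vector_operations scale)"
    "f (map b is) = sum_list (map2 scale (map u is) (map b is))"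
    using u(1) linear_combination_orderly[of "map u is"] by fastforce
  have "f (map b is) = sum_list (map (\<lambda>i. scale (u i) (b i)) is)"
    unfolding f(2) by (simp add: map2_map_map)
  also have "\<dots> = (\<Sum>i\<in>set is. scale (u i) (b i))"
    by (rule sum_list_distinct_conv_sum_set) (simp add: is_def)
  also have "\<dots> = (\<Sum>i\<in>?A. scale (u i) (b i))"
    unfolding set_is by (rule sum.mono_neutral_left) auto
  finally have "f (map b is) = 0"
    using u(2) by simp
  moreover have "set is \<noteq> {}" "set is \<subseteq> ?A"
    unfolding set_is using u(1) by blast+
  moreover from this(1) have "is \<noteq> []"
    by simp
  moreover have "sorted_wrt (<) is"
    unfolding is_def by (rule strict_sorted_list_of_set)
  ultimately show ?thesis
    using f(1) by (intro exI[of _ "is"] exI[of _ f] conjI)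
qed

lemma reduction_to_zero: "reduction (vector_operations scale) (\<lambda>_. 0) b"
proof -
  let ?K = "vector_operations scale"
  let ?m = "Suc dimension"
  \<comment> \<open>The indices are cut into consecutive disjoint windows of length
    \<open>?m\<close>, so that the supports chosen in different windows come in increasing
    order.\<close>
  have "\<forall>k. \<exists>is f. is \<noteq> [] \<and> sorted_wrt (<) is \<and> set is \<subseteq> {k * ?m..<k * ?m + ?m} \<and>
      (length is, f) \<in> orderly_terms ?K \<and> f (map b is) = 0"
    using zero_term_in_interval by blast
  then obtain I f where I: "\<And>k. I k \<noteq> []" "\<And>k. sorted_wrt (<) (I k)"
    "\<And>k. set (I k) \<subseteq> {k * ?m..<k * ?m + ?m}"
    and f: "\<And>k. (length (I k), f k) \<in> orderly_terms ?K" "\<And>k. f k (map b (I k)) = 0"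
    by metis
  have separated: "x < y" if "i < j" "x \<in> set (I i)" "y \<in> set (I j)" for i j x y
  proof -
    have "x < Suc i * ?m" "j * ?m \<le> y"
      using that I(3)[of i] I(3)[of j] by fastforce+
    moreover have "Suc i * ?m \<le> j * ?m"
      using that(1) by (intro mult_le_mono1) simp
    ultimately show ?thesis by linarith
  qed
  \<comment> \<open>The reindexing must start with \<open>I k\<close> and go on forever; the later
    lists \<open>I (k + 1)\<close>, \<open>I (k + 2)\<close> and so on supply the continuation, and
    the case \<open>n = 1\<close> reads off the initial segment.\<close>
  have "finite_subsequence (map b (I k)) b" for k
  proof -
    obtain s where s: "strict_mono s"
      "\<And>n. concat (map (\<lambda>i. I (k + i)) [0..<n])
        = map s [0..<length (concat (map (\<lambda>i. I (k + i)) [0..<n]))]"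
      by (rule increasing_blocks_enumeration[of "\<lambda>i. I (k + i)"])
        (use I(1,2) separated nat_add_left_cancel_less in blast)+
    have "I k = map s [0..<length (I k)]"
      using s(2)[of 1] by simp
    then have "map b (I k) = map (b \<circ> s) [0..<length (map b (I k))]"
      by (metis length_map map_map)
    then show ?thesis
      using s(1) unfolding finite_subsequence_def by blast
  qed
  moreover have "concat_subsequence (\<lambda>k. map b (I k)) b"
  proof -
    obtain s where s: "strict_mono s"
      "\<And>n. concat (map I [0..<n]) = map s [0..<length (concat (map I [0..<n]))]"
      using increasing_blocks_enumeration[of I] I separated by blast
    have "concat (map (\<lambda>k. map b (I k)) [0..<n]) = map b (concat (map I [0..<n]))" for n
      by (simp add: map_concat comp_def)
    then show ?thesis
      using s unfolding concat_subsequence_def Let_def by (metis length_map map_map)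
  qed
  ultimately show ?thesis
    using f unfolding reduction_def
    by (intro exI[of _ f] exI[of _ "\<lambda>k. map b (I k)"]) auto
qed

end

theorem theorem7p2:
  fixes scale :: "'f::field \<Rightarrow> 'v::ab_group_add \<Rightarrow> 'v"
    and Basis :: "'v set"
  assumes "finite_dimensional_vector_space scale Basis"
  shows "ramsey_algebra (vector_operations scale)"
proof -
  interpret finite_dimensional_vector_space scale Basis
    by (rule assms)
  show ?thesis
    unfolding ramsey_algebra_def
  proof (intro allI)
    fix b :: "nat \<Rightarrow> 'v" and X :: "'v set"
    let ?K = "vector_operations scale"
    \<comment> \<open>A set with at most one element is never split by \<open>X\<close>: the
      alternative depends only on whether \<open>0\<close> lies in \<open>X\<close>.\<close>
    have "FR ?K (\<lambda>_. 0) \<subseteq> X \<or> FR ?K (\<lambda>_. 0) \<inter> X = {}"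
      using FR_zero_sequence by blast
    then show "\<exists>a. reduction ?K a b \<and> (FR ?K a \<subseteq> X \<or> FR ?K a \<inter> X = {})"
      using reduction_to_zero by blast
  qed
qed

end
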